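(* Every contact-segment graph is a pseudo-disk graph.
   Context: A contact system of segments is a finite set of (non-degenerate) straight line segments in $\mathbb{R}^2$ such that, for any two segments, every point belonging to both of them is an endpoint of at least one of the two segments. A contact-segment graph is the intersection graph of a contact system of segments. A pseudo-disk is a subset of the plane homeomorphic to a closed disk; a finite set of pseudo-disks is a system of pseudo-disks if for any two intersecting elements their boundaries intersect in at most two points; a pseudo-disk graph is the intersection graph of a system of pseudo-disks. *)

theory Defs
  imports
    "HOL-Analysis.Analysis"
    "Graph_Theory.Pair_Digraph"
    "Graph_Theory.Digraph_Isomorphism"
begin

text \<open>
  A simple undirected graph is a \<^locale>\<open>pair_graph\<close>: a finite vertex set together with a symmetric,
  irreflexive set of vertex pairs, so an edge \<open>uv\<close> is represented by both \<open>(u, v)\<close> and \<open>(v, u)\<close>.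
\<close>

definition intersection_graph :: "'a set set \<Rightarrow> 'a set pair_pre_digraph" where
  "intersection_graph F =
     \<lparr> pverts = F, parcs = {(A, B). A \<in> F \<and> B \<in> F \<and> A \<noteq> B \<and> A \<inter> B \<noteq> {}} \<rparr>"

lemma pair_graph_intersection_graph:
  assumes "finite F"
  shows "pair_graph (intersection_graph F)"
proof
  show "finite (pverts (intersection_graph F))"
    using assms by (simp add: intersection_graph_def)
  have "parcs (intersection_graph F) \<subseteq> F \<times> F"
    by (auto simp: intersection_graph_def)
  then show "finite (parcs (intersection_graph F))"
    using assms by (meson finite_SigmaI finite_subset)
  show "symmetric (with_proj (intersection_graph F))"
    by (auto simp: symmetric_def intersection_graph_def intro!: symI)
qed (auto simp: intersection_graph_def)

definition straight_segment :: "(real ^ 2) set \<Rightarrow> bool" where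
  "straight_segment s \<longleftrightarrow> (\<exists>a b. a \<noteq> b \<and> s = closed_segment a b)"

text \<open>
  The two endpoints are determined by the point set of the segment
  (\<open>closed_segment a b = closed_segment c d\<close> iff \<open>{a, b} = {c, d}\<close>), so a segment can be
  treated as a set.
\<close>

definition segment_endpoint :: "real ^ 2 \<Rightarrow> (real ^ 2) set \<Rightarrow> bool" where
  "segment_endpoint p s \<longleftrightarrow> (\<exists>q. s = closed_segment p q)"

definition contact_system :: "(real ^ 2) set set \<Rightarrow> bool" where
  "contact_system S \<longleftrightarrow>
     finite S \<and> (\<forall>s\<in>S. straight_segment s) \<and>
     (\<forall>s\<in>S. \<forall>t\<in>S. s \<noteq> t \<longrightarrow> (\<forall>p\<in>s \<inter> t. segment_endpoint p s \<or> segment_endpoint p t))"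

definition contact_segment_graph :: "'v pair_pre_digraph \<Rightarrow> bool" where
  "contact_segment_graph G \<longleftrightarrow>
     (\<exists>S. contact_system S \<and> digraph_iso (with_proj (intersection_graph S)) (with_proj G))"

definition pseudo_disk :: "(real ^ 2) set \<Rightarrow> bool" where
  "pseudo_disk D \<longleftrightarrow> D homeomorphic (cball 0 1 :: (real ^ 2) set)"

definition pseudo_disk_system :: "(real ^ 2) set set \<Rightarrow> bool" where
  "pseudo_disk_system F \<longleftrightarrow>
     finite F \<and> (\<forall>D\<in>F. pseudo_disk D) \<and>
     (\<forall>D\<in>F. \<forall>E\<in>F. D \<noteq> E \<longrightarrow> D \<inter> E \<noteq> {} \<longrightarrow>
        finite (frontier D \<inter> frontier E) \<and> card (frontier D \<inter> frontier E) \<le> 2)"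

definition pseudo_disk_graph :: "'v pair_pre_digraph \<Rightarrow> bool" where
  "pseudo_disk_graph G \<longleftrightarrow>
     (\<exists>F. pseudo_disk_system F \<and> digraph_iso (with_proj (intersection_graph F)) (with_proj G))"

end

theory Submission
  imports Defs
begin

text \<open>
  Replace every segment by the rhombus that has it as one diagonal and whose other diagonal is
  shorter by the factor \<open>e\<close>; only pairs matter, so it suffices to treat two segments and to let
  \<open>e\<close> tend to \<open>0\<close>. Disjoint segments get disjoint rhombi. Two segments meeting in a common endpoint
  are strictly separated there by a line, so their rhombi touch only at that point. If an endpoint
  \<open>p\<close> of \<open>t\<close> is a relative interior point of \<open>s\<close>, then the rhombus of \<open>s\<close> meets the frontier of the
  rhombus of \<open>t\<close> only along its two edges at \<open>p\<close>. Each of them lies on a ray from an interior point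
  of a convex set, and such a ray meets the frontier at most once.
\<close>

section \<open>Coordinates along a segment\<close>

definition quarter_turn :: "real ^ 2 \<Rightarrow> real ^ 2" where
  "quarter_turn v = vector [- (v $ 2), v $ 1]"

text \<open>Both coordinates are measured in units of the segment's own length: \<open>a\<close> has
  coordinates 0, 0 and \<open>b\<close> has 1, 0. One parameter \<open>e\<close> then describes the
  same shape of rhombus for every segment.\<close>

definition abscissa :: "real ^ 2 \<Rightarrow> real ^ 2 \<Rightarrow> real ^ 2 \<Rightarrow> real" where
  "abscissa a b x = (x - a) \<bullet> (b - a) / ((b - a) \<bullet> (b - a))"

definition ordinate :: "real ^ 2 \<Rightarrow> real ^ 2 \<Rightarrow> real ^ 2 \<Rightarrow> real" where
  "ordinate a b x = (x - a) \<bullet> quarter_turn (b - a) / ((b - a) \<bullet> (b - a))"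

lemma quarter_turn_nth [simp]:
  "quarter_turn v $ 1 = - (v $ 2)" "quarter_turn v $ 2 = v $ 1"
  by (simp_all add: quarter_turn_def)

lemma norm_quarter_turn [simp]: "norm (quarter_turn v) = norm v"
  by (simp add: norm_eq_sqrt_inner inner_vec_def sum_2)

lemma quarter_turn_orthogonal [simp]: "v \<bullet> quarter_turn v = 0"
  by (simp add: inner_vec_def sum_2)

lemma quarter_turn_minus: "quarter_turn (a - b) = - quarter_turn (b - a)"
  by (simp add: vec_eq_iff forall_2)

text \<open>For \<open>a \<noteq> b\<close> the vectors \<open>b - a\<close> and
  \<open>quarter_turn (b - a)\<close> are orthogonal and of equal nonzero length, hence a basis; the
  coefficients are orthogonal projections.\<close>

lemma coordinates:
  assumes "a \<noteq> b"
  shows "x = a + abscissa a b x *\<^sub>R (b - a) + ordinate a b x *\<^sub>R quarter_turn (b - a)"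
proof -
  define d where "d = b - a"
  define y where "y = x - a"
  \<comment> \<open>This is \<open>d \<bullet> d\<close> in components, the denominator to be
    cleared.\<close>
  have n: "d $ 1 * d $ 1 + d $ 2 * d $ 2 \<noteq> 0"
    using assms by (auto simp: d_def sum_squares_eq_zero_iff vec_eq_iff forall_2)
  have "y = (y \<bullet> d / (d \<bullet> d)) *\<^sub>R d + (y \<bullet> quarter_turn d / (d \<bullet> d)) *\<^sub>R quarter_turn d"
    using n by (auto simp: vec_eq_iff forall_2 inner_vec_def sum_2 divide_simps) (simp_all add: algebra_simps)
  then show ?thesis
    by (simp add: abscissa_def ordinate_def d_def y_def algebra_simps)
qed

lemma
  assumes "a \<noteq> b"
  shows abscissa_on_line: "abscissa a b (a + t *\<^sub>R (b - a)) = t"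
    and ordinate_on_line: "ordinate a b (a + t *\<^sub>R (b - a)) = 0"
  using assms by (simp_all add: abscissa_def ordinate_def)

text \<open>Exchanging the endpoints turns the frame by a half turn about the midpoint. With
  \<open>ordinate_swap\<close> this makes the rhombus independent of the orientation of its
  segment.\<close>

lemma abscissa_swap:
  assumes "a \<noteq> b"
  shows "abscissa b a x = 1 - abscissa a b x"
proof -
  have "(b - a) \<bullet> (b - a) \<noteq> 0" using assms by simp
  moreover have "(a - b) \<bullet> (a - b) = (b - a) \<bullet> (b - a)"
    by (simp add: inner_diff_left inner_diff_right inner_commute)
  moreover have "(x - b) \<bullet> (a - b) = (b - a) \<bullet> (b - a) - (x - a) \<bullet> (b - a)"
    by (simp add: inner_diff_left inner_diff_right inner_commute)
  ultimately show ?thesis by (simp add: abscissa_def diff_divide_distrib)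
qed

lemma ordinate_swap: "ordinate b a x = - ordinate a b x"
proof -
  have "(b - a) \<bullet> quarter_turn (b - a) = 0" by simp
  then have "(x - b) \<bullet> quarter_turn (b - a) = (x - a) \<bullet> quarter_turn (b - a)"
    unfolding inner_diff_left by linarith
  moreover have "(a - b) \<bullet> (a - b) = (b - a) \<bullet> (b - a)"
    by (simp add: inner_diff_left inner_diff_right inner_commute)
  ultimately show ?thesis by (simp add: ordinate_def quarter_turn_minus[of a b])
qed

section \<open>Affinity and continuity of the coordinates\<close>

lemma abscissa_affine:
  "u + v = 1 \<Longrightarrow> abscissa a b (u *\<^sub>R x + v *\<^sub>R y) = u * abscissa a b x + v * abscissa a b y"
proof -
  assume "u + v = 1"
  then have "u *\<^sub>R x + v *\<^sub>R y - a = u *\<^sub>R (x - a) + v *\<^sub>R (y - a)"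
    by (simp add: algebra_simps flip: scaleR_add_left)
  then show ?thesis by (simp add: abscissa_def inner_add_left add_divide_distrib)
qed

lemma ordinate_affine:
  "u + v = 1 \<Longrightarrow> ordinate a b (u *\<^sub>R x + v *\<^sub>R y) = u * ordinate a b x + v * ordinate a b y"
proof -
  assume "u + v = 1"
  then have "u *\<^sub>R x + v *\<^sub>R y - a = u *\<^sub>R (x - a) + v *\<^sub>R (y - a)"
    by (simp add: algebra_simps flip: scaleR_add_left)
  then show ?thesis by (simp add: ordinate_def inner_add_left add_divide_distrib)
qed

lemma continuous_abscissa [continuous_intros]: "continuous_on S (abscissa a b)"
  unfolding abscissa_def divide_inverse by (intro continuous_intros)

lemma continuous_ordinate [continuous_intros]: "continuous_on S (ordinate a b)"
  unfolding ordinate_def divide_inverse by (intro continuous_intros)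

lemma in_segment_base:
  "x \<in> closed_segment a b \<longleftrightarrow> (\<exists>t. 0 \<le> t \<and> t \<le> 1 \<and> x = a + t *\<^sub>R (b - a))"
  for a b :: "'a :: real_vector"
  by (auto simp: in_segment algebra_simps)

section \<open>Thin rhombi\<close>

text \<open>The two conditions bound the angles at \<open>a\<close> and at \<open>b\<close>. The
  vertices are \<open>a\<close>, \<open>b\<close> and the two points with abscissa 1/2 and ordinate
  e/2 or -e/2.\<close>

definition rhombus :: "real \<Rightarrow> real ^ 2 \<Rightarrow> real ^ 2 \<Rightarrow> (real ^ 2) set" where
  "rhombus e a b =
    {x. \<bar>ordinate a b x\<bar> \<le> e * abscissa a b x \<and> \<bar>ordinate a b x\<bar> \<le> e * (1 - abscissa a b x)}"

lemma rhombus_commute: "a \<noteq> b \<Longrightarrow> rhombus e b a = rhombus e a b"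
  by (auto simp: rhombus_def abscissa_swap[of a b] ordinate_swap[of b a])

lemma segment_subset_rhombus:
  assumes "a \<noteq> b" "0 < e"
  shows "closed_segment a b \<subseteq> rhombus e a b"
  using assms by (auto simp: in_segment_base rhombus_def abscissa_on_line ordinate_on_line)

lemma abscissa_rhombus:
  assumes "x \<in> rhombus e a b" "0 < e"
  shows "0 \<le> abscissa a b x" "abscissa a b x \<le> 1" "\<bar>ordinate a b x\<bar> \<le> e"
proof -
  have o: "\<bar>ordinate a b x\<bar> \<le> e * abscissa a b x" "\<bar>ordinate a b x\<bar> \<le> e * (1 - abscissa a b x)"
    using assms by (auto simp: rhombus_def)
  then have "0 \<le> e * abscissa a b x" "0 \<le> e * (1 - abscissa a b x)"
    using abs_ge_zero order_trans by blast+
  then show *: "0 \<le> abscissa a b x" "abscissa a b x \<le> 1"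
    using \<open>0 < e\<close> by (auto simp: zero_le_mult_iff)
  have "e * (1 - abscissa a b x) \<le> e * 1"
    using * \<open>0 < e\<close> by (intro mult_left_mono) auto
  with o show "\<bar>ordinate a b x\<bar> \<le> e" by linarith
qed

text \<open>The point on the axis is the foot of the perpendicular from \<open>x\<close>, so the
  distance is the absolute ordinate times \<open>norm (b - a)\<close>. The bound tends to 0 with
  \<open>e\<close>, which is what thinness means below.\<close>

lemma rhombus_dist_axis:
  assumes "x \<in> rhombus e a b" "0 < e" "a \<noteq> b"
  shows "dist x (a + abscissa a b x *\<^sub>R (b - a)) \<le> e * norm (b - a)"
proof -
  have "x - (a + abscissa a b x *\<^sub>R (b - a)) = ordinate a b x *\<^sub>R quarter_turn (b - a)"
    using coordinates[OF \<open>a \<noteq> b\<close>, of x] by (metis add_diff_cancel_left')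
  then show ?thesis
    using abscissa_rhombus[OF assms(1,2)] by (simp add: dist_norm mult_right_mono)
qed

text \<open>The absolute ordinate is a convex function by the triangle inequality, and both of its
  bounds are affine functions.\<close>

lemma convex_rhombus: "0 < e \<Longrightarrow> convex (rhombus e a b)"
proof (rule convexI)
  fix x y and u v :: real
  assume *: "0 < e" "x \<in> rhombus e a b" "y \<in> rhombus e a b" "0 \<le> u" "0 \<le> v" "u + v = 1"
  let ?o = "ordinate a b" and ?s = "abscissa a b"
  have "\<bar>u * ?o x + v * ?o y\<bar> \<le> u * \<bar>?o x\<bar> + v * \<bar>?o y\<bar>"
    using * by (metis abs_mult abs_of_nonneg abs_triangle_ineq)
  moreover have "u * \<bar>?o x\<bar> + v * \<bar>?o y\<bar> \<le> u * (e * ?s x) + v * (e * ?s y)"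
    using * by (intro add_mono mult_left_mono) (auto simp: rhombus_def)
  moreover have "u * \<bar>?o x\<bar> + v * \<bar>?o y\<bar> \<le> u * (e * (1 - ?s x)) + v * (e * (1 - ?s y))"
    using * by (intro add_mono mult_left_mono) (auto simp: rhombus_def)
  moreover have "u * (e * (1 - ?s x)) + v * (e * (1 - ?s y)) = e * (1 - (u * ?s x + v * ?s y))"
  proof -
    have v: "v = 1 - u" using * by simp
    show ?thesis unfolding v by algebra
  qed
  ultimately show "u *\<^sub>R x + v *\<^sub>R y \<in> rhombus e a b"
    by (simp add: rhombus_def abscissa_affine[OF *(6)] ordinate_affine[OF *(6)] algebra_simps)
qed

lemma closed_rhombus: "closed (rhombus e a b)"
  unfolding rhombus_def by (intro closed_Collect_conj closed_Collect_le continuous_intros)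

lemma compact_rhombus:
  assumes "0 < e" "a \<noteq> b"
  shows "compact (rhombus e a b)"
proof -
  have "norm (x - a) \<le> norm (b - a) + e * norm (b - a)" if x: "x \<in> rhombus e a b" for x
  proof -
    have "x - a = abscissa a b x *\<^sub>R (b - a) + ordinate a b x *\<^sub>R quarter_turn (b - a)"
      using coordinates[OF \<open>a \<noteq> b\<close>, of x] by (metis add.assoc add_diff_cancel_left')
    also have "norm \<dots> \<le> \<bar>abscissa a b x\<bar> * norm (b - a) + \<bar>ordinate a b x\<bar> * norm (b - a)"
      by (metis norm_quarter_turn norm_scaleR norm_triangle_ineq)
    also have "\<dots> \<le> 1 * norm (b - a) + e * norm (b - a)"
      using abscissa_rhombus[OF x \<open>0 < e\<close>] by (intro add_mono mult_right_mono) auto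
    finally show ?thesis by simp
  qed
  then have "rhombus e a b \<subseteq> cball a (norm (b - a) + e * norm (b - a))"
    by (auto simp: dist_norm norm_minus_commute)
  then show ?thesis
    using closed_rhombus bounded_subset[OF bounded_cball] compact_eq_bounded_closed by blast
qed

text \<open>Strict inequalities between continuous functions cut out an open subset of the
  rhombus.\<close>

lemma interior_rhombus_supset:
  "{x. \<bar>ordinate a b x\<bar> < e * abscissa a b x \<and> \<bar>ordinate a b x\<bar> < e * (1 - abscissa a b x)}
    \<subseteq> interior (rhombus e a b)"
proof (rule interior_maximal)
  show "open {x. \<bar>ordinate a b x\<bar> < e * abscissa a b x \<and> \<bar>ordinate a b x\<bar> < e * (1 - abscissa a b x)}"
    by (intro open_Collect_conj open_Collect_less continuous_intros)
qed (auto simp: rhombus_def)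

lemma open_segment_interior_rhombus:
  assumes "a \<noteq> b" "0 < e"
  shows "open_segment a b \<subseteq> interior (rhombus e a b)"
proof
  fix x assume "x \<in> open_segment a b"
  then obtain t where "0 < t" "t < 1" "x = a + t *\<^sub>R (b - a)"
    by (auto simp: in_segment algebra_simps)
  with assms show "x \<in> interior (rhombus e a b)"
    by (intro subsetD[OF interior_rhombus_supset])
      (auto simp: abscissa_on_line ordinate_on_line)
qed

text \<open>A compact convex set with nonempty interior is homeomorphic to a closed ball; the
  midpoint of the axis is an interior point.\<close>

lemma pseudo_disk_rhombus:
  assumes "a \<noteq> b" "0 < e"
  shows "pseudo_disk (rhombus e a b)"
proof -
  have "midpoint a b \<in> interior (rhombus e a b)"
    using open_segment_interior_rhombus[OF assms] assms by auto
  then show ?thesis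
    unfolding pseudo_disk_def using assms
    by (intro homeomorphic_convex_compact_cball convex_rhombus compact_rhombus) auto
qed

text \<open>On the half nearer to \<open>a\<close> only the constraint belonging to \<open>a\<close>
  can be tight, and tightness puts the point on one of the two rays that extend the edges at
  \<open>a\<close>.\<close>

lemma frontier_rhombus_cases:
  assumes "x \<in> frontier (rhombus e a b)" "0 < e" "a \<noteq> b"
  obtains (near) t where "0 \<le> t" "x = a + t *\<^sub>R (b - a + e *\<^sub>R quarter_turn (b - a))
      \<or> x = a + t *\<^sub>R (b - a - e *\<^sub>R quarter_turn (b - a))"
  | (far) "1 / 2 \<le> abscissa a b x"
proof (cases "1 / 2 \<le> abscissa a b x")
  case True then show ?thesis using far by blast
next
  case False
  let ?s = "abscissa a b x" and ?o = "ordinate a b x"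
  have x: "x \<in> rhombus e a b" "x \<notin> interior (rhombus e a b)"
    using assms closed_rhombus by (auto simp: frontier_def)
  then have "\<not> (\<bar>?o\<bar> < e * ?s \<and> \<bar>?o\<bar> < e * (1 - ?s))"
    using interior_rhombus_supset by blast
  \<comment> \<open>The bound belonging to \<open>a\<close> is the smaller one here, so it is the
    one attained.\<close>
  moreover have "e * ?s < e * (1 - ?s)" using False \<open>0 < e\<close> by simp
  ultimately have "\<bar>?o\<bar> = e * ?s" using x by (auto simp: rhombus_def)
  then consider "?o = e * ?s" | "?o = - (e * ?s)" by linarith
  then show ?thesis
  proof cases
    case 1
    then have "x = a + ?s *\<^sub>R (b - a + e *\<^sub>R quarter_turn (b - a))"
      using coordinates[OF \<open>a \<noteq> b\<close>, of x] by (simp add: scaleR_add_right mult.commute add.assoc)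
    with near abscissa_rhombus(1)[OF x(1) \<open>0 < e\<close>] show ?thesis by blast
  next
    case 2
    then have "x = a + ?s *\<^sub>R (b - a - e *\<^sub>R quarter_turn (b - a))"
      using coordinates[OF \<open>a \<noteq> b\<close>, of x] by (simp add: algebra_simps)
    with near abscissa_rhombus(1)[OF x(1) \<open>0 < e\<close>] show ?thesis by blast
  qed
qed

text \<open>Of two distinct frontier points on the ray, the nearer one would lie strictly between
  the interior point \<open>p\<close> and a point of the closure, hence in the interior.\<close>

lemma ray_frontier_unique:
  fixes p v :: "'a :: euclidean_space"
  assumes "convex S" "p \<in> interior S" "0 \<le> s" "0 \<le> t"
    and "p + s *\<^sub>R v \<in> frontier S" "p + t *\<^sub>R v \<in> frontier S"
  shows "p + s *\<^sub>R v = p + t *\<^sub>R v"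
proof -
  have False if "0 \<le> s" "s < t" "p + s *\<^sub>R v \<in> frontier S" "p + t *\<^sub>R v \<in> frontier S" "v \<noteq> 0" for s t
  proof -
    have "0 < s" using that \<open>p \<in> interior S\<close> by (cases "s = 0") (auto simp: frontier_def)
    with that have "p + s *\<^sub>R v \<in> open_segment p (p + t *\<^sub>R v)"
      by (auto simp: in_segment algebra_simps intro!: exI[of _ "s / t"])
    moreover have "p + t *\<^sub>R v \<in> closure S" using that by (auto simp: frontier_def)
    ultimately have "p + s *\<^sub>R v \<in> interior S"
      using in_interior_closure_convex_segment assms by blast
    with that show False by (simp add: frontier_def)
  qed
  from this[of s t] this[of t s] assms show ?thesis
    by (cases s t rule: linorder_cases; cases "v = 0") auto
qed

section \<open>Pairs of thin rhombi\<close>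

text \<open>A common point has a foot on each axis, and for small \<open>e\<close> these feet are
  closer together than the positive distance between \<open>A\<close> and \<open>B\<close>. Leaving
  \<open>A\<close> and \<open>B\<close> free covers whole segments as well as the outer half of
  one.\<close>

lemma eventually_rhombi_apart:
  fixes A B :: "(real ^ 2) set"
  assumes "compact A" "compact B" "A \<inter> B = {}" "a \<noteq> b" "c \<noteq> d"
  shows "\<forall>\<^sub>F e in at_right 0. \<forall>x. x \<in> rhombus e a b \<longrightarrow> x \<in> rhombus e c d \<longrightarrow>
    a + abscissa a b x *\<^sub>R (b - a) \<in> A \<longrightarrow> c + abscissa c d x *\<^sub>R (d - c) \<in> B \<longrightarrow> False"
proof -
  obtain \<delta> where \<delta>: "0 < \<delta>" "\<And>x y. x \<in> A \<Longrightarrow> y \<in> B \<Longrightarrow> \<delta> \<le> dist x y"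
    using separate_compact_closed[OF \<open>compact A\<close> compact_imp_closed[OF \<open>compact B\<close>] assms(3)] by blast
  have "((\<lambda>e. e * norm (b - a) + e * norm (d - c)) \<longlongrightarrow> 0 * norm (b - a) + 0 * norm (d - c)) (at_right 0)"
    by (intro tendsto_intros)
  then have "\<forall>\<^sub>F e in at_right 0. e * norm (b - a) + e * norm (d - c) < \<delta>"
    using \<delta>(1) by (auto dest: order_tendstoD(2))
  with eventually_at_right_less[of 0] show ?thesis
  proof eventually_elim
    case (elim e)
    then show ?case
      using rhombus_dist_axis[of _ e a b] rhombus_dist_axis[of _ e c d] assms(4,5) \<delta>(2)
      by (smt (verit) dist_commute dist_triangle)
  qed
qed

lemma axis_in_segment:
  assumes "x \<in> rhombus e a b" "0 < e"
  shows "a + abscissa a b x *\<^sub>R (b - a) \<in> closed_segment a b"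
  using abscissa_rhombus[OF assms] by (auto simp: in_segment_base)

lemma eventually_rhombi_disjoint:
  assumes "closed_segment a b \<inter> closed_segment c d = {}" "a \<noteq> b" "c \<noteq> d"
  shows "\<forall>\<^sub>F e in at_right 0. rhombus e a b \<inter> rhombus e c d = {}"
  using eventually_rhombi_apart[OF compact_segment compact_segment assms] eventually_at_right_less[of 0]
  by eventually_elim (use axis_in_segment in blast)

text \<open>The ordinate is at most \<open>e\<close> times the abscissa, so both terms of
  \<open>w \<bullet> (x - a)\<close> scale with the abscissa. One small \<open>e\<close> therefore
  works uniformly, even arbitrarily close to the tip.\<close>

lemma eventually_rhombus_half_plane:
  assumes "a \<noteq> b" "0 < w \<bullet> (b - a)"
  shows "\<forall>\<^sub>F e in at_right 0. \<forall>x \<in> rhombus e a b. x \<noteq> a \<longrightarrow> 0 < w \<bullet> (x - a)"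
proof -
  let ?q = "w \<bullet> quarter_turn (b - a)"
  have "((\<lambda>e. e * \<bar>?q\<bar>) \<longlongrightarrow> 0 * \<bar>?q\<bar>) (at_right 0)"
    by (intro tendsto_intros)
  then have "\<forall>\<^sub>F e in at_right 0. e * \<bar>?q\<bar> < w \<bullet> (b - a)"
    using assms(2) by (auto dest: order_tendstoD(2))
  with eventually_at_right_less[of 0] show ?thesis
  proof eventually_elim
    case (elim e)
    show ?case
    proof (intro ballI impI)
      fix x assume x: "x \<in> rhombus e a b" "x \<noteq> a"
      let ?s = "abscissa a b x" and ?o = "ordinate a b x"
      have o: "\<bar>?o\<bar> \<le> e * ?s" using x by (simp add: rhombus_def)
      have eq: "x - a = ?s *\<^sub>R (b - a) + ?o *\<^sub>R quarter_turn (b - a)"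
        using coordinates[OF \<open>a \<noteq> b\<close>, of x] by (metis add.assoc add_diff_cancel_left')
      \<comment> \<open>At abscissa 0 the rhombus contains only the tip \<open>a\<close>.\<close>
      have "?s \<noteq> 0"
      proof
        assume "?s = 0"
        with o have "?o = 0" by simp
        with eq \<open>?s = 0\<close> x show False by simp
      qed
      then have "0 < ?s" using abscissa_rhombus(1)[OF x(1)] elim by simp
      have "\<bar>?o * ?q\<bar> \<le> (e * ?s) * \<bar>?q\<bar>"
        using o by (simp add: abs_mult mult_right_mono)
      also have "\<dots> = ?s * (e * \<bar>?q\<bar>)" by simp
      also have "\<dots> < ?s * (w \<bullet> (b - a))"
        using elim \<open>0 < ?s\<close> by (simp only: mult_strict_left_mono)
      finally show "0 < w \<bullet> (x - a)"
        unfolding eq by (simp add: inner_add_right)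
    qed
  qed
qed

text \<open>Segments that share only \<open>p\<close> do not leave it in the same direction, so the
  Cauchy-Schwarz inequality is strict. The difference of the unit directions is then a normal vector
  that puts the two rhombi, apart from \<open>p\<close>, in opposite open half planes.\<close>

lemma eventually_rhombi_share_tip:
  assumes "closed_segment p a \<inter> closed_segment p b = {p}" "p \<noteq> a" "p \<noteq> b"
  shows "\<forall>\<^sub>F e in at_right 0. rhombus e p a \<inter> rhombus e p b = {p}"
proof -
  let ?u = "a - p" and ?v = "b - p"
  have *: "?u \<bullet> ?v < norm ?u * norm ?v"
  proof (rule ccontr)
    assume "\<not> ?thesis"
    then have "?u \<bullet> ?v = norm ?u * norm ?v"
      using norm_cauchy_schwarz[of ?u ?v] by simp
    then have e: "norm ?u *\<^sub>R ?v = norm ?v *\<^sub>R ?u" by (simp add: norm_cauchy_schwarz_eq)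
    \<comment> \<open>With equal directions, the point at distance \<open>l\<close> from
      \<open>p\<close>, the length of the shorter segment, would lie on both segments.\<close>
    define l where "l = min (norm ?u) (norm ?v)"
    have l: "0 < l" "l \<le> norm ?u" "l \<le> norm ?v" using assms by (auto simp: l_def)
    have "?v = (1 / norm ?u) *\<^sub>R (norm ?u *\<^sub>R ?v)" using assms by simp
    also have "\<dots> = (norm ?v / norm ?u) *\<^sub>R ?u" unfolding e by simp
    finally have "(l / norm ?v) *\<^sub>R ?v = (l / norm ?v) *\<^sub>R (norm ?v / norm ?u) *\<^sub>R ?u"
      by (rule arg_cong)
    then have "(l / norm ?v) *\<^sub>R ?v = (l / norm ?u) *\<^sub>R ?u"
      using assms by simp
    moreover have "l / norm ?u \<le> 1" "l / norm ?v \<le> 1" "0 \<le> l / norm ?u" "0 \<le> l / norm ?v"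
      using l by (auto simp: divide_le_eq_1)
    ultimately have "p + (l / norm ?u) *\<^sub>R ?u \<in> closed_segment p a"
      and "p + (l / norm ?u) *\<^sub>R ?u \<in> closed_segment p b"
      unfolding in_segment_base by metis+
    then have "p + (l / norm ?u) *\<^sub>R ?u = p"
      by (metis IntI assms(1) singletonD)
    moreover have "(l / norm ?u) *\<^sub>R ?u \<noteq> 0" using l assms by auto
    ultimately show False by simp
  qed
  \<comment> \<open>\<open>w\<close> is the positive multiple \<open>norm ?u * norm ?v\<close> of the difference of the two unit directions.\<close>
  define w where "w = norm ?v *\<^sub>R ?u - norm ?u *\<^sub>R ?v"
  \<comment> \<open>Exchanging \<open>x\<close> and \<open>y\<close> reverses the sign of the left
    vector, so this identity serves both \<open>w\<close> with \<open>?u\<close> and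
    \<open>- w\<close> with \<open>?v\<close>.\<close>
  have dot: "(norm y *\<^sub>R x - norm x *\<^sub>R y) \<bullet> x = norm x * (norm x * norm y - x \<bullet> y)"
    for x y :: "real ^ 2"
    by (simp add: inner_diff_left inner_commute[of y] dot_square_norm power2_eq_square algebra_simps)
  have "w \<bullet> ?u = norm ?u * (norm ?u * norm ?v - ?u \<bullet> ?v)"
    unfolding w_def by (rule dot)
  moreover have "(- w) \<bullet> ?v = norm ?v * (norm ?u * norm ?v - ?u \<bullet> ?v)"
    using dot[of ?u ?v] unfolding w_def minus_diff_eq by (simp only: inner_commute mult.commute)
  ultimately have "0 < w \<bullet> ?u" "0 < (- w) \<bullet> ?v"
    using * assms by auto
  from eventually_rhombus_half_plane[OF assms(2) this(1)] eventually_rhombus_half_plane[OF assms(3) this(2)]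
    eventually_at_right_less[of 0]
  show ?thesis
  proof eventually_elim
    case (elim e)
    then have "p \<in> rhombus e p a" "p \<in> rhombus e p b"
      using segment_subset_rhombus assms ends_in_segment by blast+
    moreover have "x = p" if "x \<in> rhombus e p a" "x \<in> rhombus e p b" for x
      using elim(1,2) that by fastforce
    ultimately show ?case by blast
  qed
qed

text \<open>The outer half of the segment from \<open>p\<close> to \<open>a\<close> has positive
  distance from the other segment, so for small \<open>e\<close> the rhombi meet only where the
  abscissa along this segment is below 1/2. There the frontier of the first rhombus consists of its
  edges at \<open>p\<close>, an interior point of the second.\<close>

lemma eventually_rhombi_cross:
  assumes "closed_segment p a \<inter> closed_segment c d = {p}" "p \<noteq> a" "p \<in> open_segment c d"
  shows "\<forall>\<^sub>F e in at_right 0. rhombus e p a \<noteq> rhombus e c d \<and>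
    finite (frontier (rhombus e p a) \<inter> frontier (rhombus e c d)) \<and>
    card (frontier (rhombus e p a) \<inter> frontier (rhombus e c d)) \<le> 2"
proof -
  have cd: "c \<noteq> d" using assms(3) by auto
  let ?A = "closed_segment (midpoint p a) a"
  have "p \<notin> ?A"
  proof
    assume "p \<in> ?A"
    then obtain t where t: "0 \<le> t" "p = midpoint p a + t *\<^sub>R (a - midpoint p a)"
      by (auto simp: in_segment_base)
    have "((1 + t) / 2) *\<^sub>R (a - p) = midpoint p a + t *\<^sub>R (a - midpoint p a) - p"
      by (simp add: midpoint_def vec_eq_iff field_simps)
    with t \<open>p \<noteq> a\<close> show False by simp
  qed
  moreover have "?A \<subseteq> closed_segment p a"
    by (simp add: subset_closed_segment)
  moreover have "x = p" if "x \<in> closed_segment p a" "x \<in> closed_segment c d" for x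
    using assms(1) that by auto
  ultimately have "?A \<inter> closed_segment c d = {}"
    by (intro equals0I) (metis IntE subsetD)
  note apart = eventually_rhombi_apart[OF compact_segment compact_segment this assms(2) cd]
  from apart eventually_at_right_less[of 0] show ?thesis
  proof eventually_elim
    case (elim e)
    let ?R = "rhombus e p a" and ?S = "rhombus e c d"
    have near_tip: "abscissa p a x < 1 / 2" if "x \<in> ?R" "x \<in> ?S" for x
    proof (rule ccontr)
      assume "\<not> ?thesis"
      moreover have "abscissa p a x \<le> 1" using abscissa_rhombus(2) that elim by blast
      \<comment> \<open>Abscissa \<open>s\<close> on the whole segment corresponds to parameter
        \<open>2 * s - 1\<close> on its outer half.\<close>
      ultimately have "p + abscissa p a x *\<^sub>R (a - p) \<in> ?A"
        unfolding in_segment_base midpoint_def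
        by (intro exI[of _ "2 * abscissa p a x - 1"])
          (auto simp: vec_eq_iff field_simps)
      then show False using elim that axis_in_segment by blast
    qed
    \<comment> \<open>The far tip \<open>a\<close> has abscissa 1, so it cannot belong to
      \<open>?S\<close>, and the rhombi differ.\<close>
    have "a \<in> ?R" using segment_subset_rhombus assms(2) elim ends_in_segment by blast
    moreover have "abscissa p a a = 1" using abscissa_on_line[OF assms(2), of 1] by simp
    ultimately have "?R \<noteq> ?S" using near_tip[of a] by auto
    have p: "p \<in> interior ?S"
      using open_segment_interior_rhombus[OF cd] elim assms(3) by blast
    have conv: "convex ?S" using convex_rhombus elim by blast
    let ?ray = "\<lambda>v. {x. \<exists>t\<ge>0. x = p + t *\<^sub>R v} \<inter> frontier ?S"
    have ray: "finite (?ray v) \<and> card (?ray v) \<le> 1" for v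
    proof -
      have unique: "x = y" if "x \<in> ?ray v" "y \<in> ?ray v" for x y
        using ray_frontier_unique[OF conv p] that by blast
      have "\<exists>x. ?ray v \<subseteq> {x}"
      proof (cases "?ray v = {}")
        case False
        then obtain x where "x \<in> ?ray v" by blast
        then show ?thesis using unique[of _ x] by (intro exI[of _ x] subsetI) simp
      qed simp
      then obtain x where "?ray v \<subseteq> {x}" by blast
      then show ?thesis
        using card_mono[of "{x}" "?ray v"] finite_subset[of "?ray v" "{x}"] by simp
    qed
    let ?v = "a - p + e *\<^sub>R quarter_turn (a - p)" and ?w = "a - p - e *\<^sub>R quarter_turn (a - p)"
    have "frontier ?R \<inter> frontier ?S \<subseteq> ?ray ?v \<union> ?ray ?w"
    proof
      fix x assume x: "x \<in> frontier ?R \<inter> frontier ?S"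
      then have "x \<in> frontier ?R" "x \<in> ?R" "x \<in> ?S"
        using closed_rhombus frontier_subset_closed by blast+
      from this(1) elim(2) assms(2) show "x \<in> ?ray ?v \<union> ?ray ?w"
      proof (cases rule: frontier_rhombus_cases)
        case (near t)
        then show ?thesis using x by blast
      next
        case far
        with near_tip[OF \<open>x \<in> ?R\<close> \<open>x \<in> ?S\<close>] show ?thesis by simp
      qed
    qed
    moreover have "card (?ray ?v \<union> ?ray ?w) \<le> 2"
      using card_Un_le[of "?ray ?v" "?ray ?w"] ray[of ?v] ray[of ?w] by linarith
    moreover have "finite (?ray ?v \<union> ?ray ?w)" using ray by blast
    ultimately show ?case
      using \<open>?R \<noteq> ?S\<close> by (meson card_mono finite_subset le_trans)
  qed
qed

section \<open>Contact systems\<close>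

text \<open>Endpoints of a segment are extreme points, while the midpoint of two distinct points of
  a set is never an extreme point of it.\<close>

lemma segment_endpoint_not_midpoint:
  assumes "segment_endpoint (midpoint x y) s" "x \<in> s" "y \<in> s"
  shows "x = y"
proof -
  obtain q where s: "s = closed_segment (midpoint x y) q"
    using assms(1) by (auto simp: segment_endpoint_def)
  have "midpoint x y extreme_point_of s"
    unfolding s by (simp add: extreme_point_of_segment)
  then show ?thesis
    using assms(2,3) by (metis extreme_point_of_def midpoint_in_open_segment)
qed

text \<open>By convexity the midpoint of two common points is common too, so it is an endpoint of
  one of the segments; this forces the two points to coincide.\<close>

lemma contact_system_Int_unique:
  assumes "contact_system S" "s \<in> S" "t \<in> S" "s \<noteq> t" "x \<in> s \<inter> t" "y \<in> s \<inter> t"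
  shows "x = y"
proof -
  have "convex s" "convex t"
    using assms by (auto simp: contact_system_def straight_segment_def)
  then have "midpoint x y \<in> s \<inter> t"
    using assms(5,6) by (meson IntD1 IntD2 IntI closed_segment_subset midpoint_in_closed_segment subsetD)
  then have "segment_endpoint (midpoint x y) s \<or> segment_endpoint (midpoint x y) t"
    using assms by (simp add: contact_system_def)
  then show ?thesis using segment_endpoint_not_midpoint assms by blast
qed

text \<open>A contact system consists of point sets without ordered endpoints. The description is
  well defined for nondegenerate segments because \<open>rhombus_commute\<close> makes the order
  irrelevant.\<close>

definition segment_rhombus :: "real \<Rightarrow> (real ^ 2) set \<Rightarrow> (real ^ 2) set" where
  "segment_rhombus e s = (THE R. \<exists>a b. s = closed_segment a b \<and> R = rhombus e a b)"

lemma segment_rhombus_closed_segment: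
  assumes "a \<noteq> b"
  shows "segment_rhombus e (closed_segment a b) = rhombus e a b"
  unfolding segment_rhombus_def
proof (rule the_equality)
  fix R assume "\<exists>a' b'. closed_segment a b = closed_segment a' b' \<and> R = rhombus e a' b'"
  then show "R = rhombus e a b"
    using rhombus_commute[OF assms] by (auto simp: doubleton_eq_iff)
qed blast

text \<open>This collects what a pair must satisfy in the end: distinctness yields an injective map
  on segments, the equivalence preserves edges, and the rest is the pseudo-disk condition.\<close>

definition faithful_pair :: "(real ^ 2) set \<Rightarrow> (real ^ 2) set \<Rightarrow> (real ^ 2) set \<Rightarrow> (real ^ 2) set \<Rightarrow> bool" where
  "faithful_pair s t D E \<longleftrightarrow> D \<noteq> E \<and> (D \<inter> E \<noteq> {} \<longleftrightarrow> s \<inter> t \<noteq> {}) \<and>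
     finite (frontier D \<inter> frontier E) \<and> card (frontier D \<inter> frontier E) \<le> 2"

lemma faithful_pair_commute: "faithful_pair s t D E \<longleftrightarrow> faithful_pair t s E D"
  by (auto simp: faithful_pair_def Int_commute)

lemma eventually_faithful_pair_endpoint:
  assumes "straight_segment s" "straight_segment t" "s \<inter> t = {p}" "segment_endpoint p t"
  shows "\<forall>\<^sub>F e in at_right 0. faithful_pair t s (segment_rhombus e t) (segment_rhombus e s)"
proof -
  obtain a where t: "t = closed_segment p a" using assms by (auto simp: segment_endpoint_def)
  have pa: "p \<noteq> a" using assms(2) by (auto simp: t straight_segment_def)
  obtain c d where s: "s = closed_segment c d" "c \<noteq> d"
    using assms by (auto simp: straight_segment_def)
  note rt = segment_rhombus_closed_segment[OF pa, folded t]
  note rs = segment_rhombus_closed_segment[OF s(2), folded s(1)]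
  have meet: "segment_rhombus e t \<inter> segment_rhombus e s \<noteq> {}" if "0 < e" for e
  proof -
    have "p \<in> t" "p \<in> s" using assms(3) by auto
    then have "p \<in> segment_rhombus e t" "p \<in> segment_rhombus e s"
      unfolding rt rs
      using segment_subset_rhombus[OF pa that, folded t] segment_subset_rhombus[OF s(2) that, folded s(1)]
      by auto
    then show ?thesis by blast
  qed
  \<comment> \<open>The contact point is either in the relative interior of \<open>s\<close> or an
    endpoint of both segments.\<close>
  consider "p \<in> open_segment c d" | b where "s = closed_segment p b" "p \<noteq> b"
    using assms(3) s by (metis IntD1 closed_segment_commute insertI1 open_segment_def Diff_iff insert_iff empty_iff)
  then show ?thesis
  proof cases
    case 1
    have "closed_segment p a \<inter> closed_segment c d = {p}" using assms(3) s t by blast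
    from eventually_rhombi_cross[OF this pa 1] eventually_at_right_less[of 0] show ?thesis
      by eventually_elim (use meet assms(3) in \<open>auto simp: faithful_pair_def rt rs\<close>)
  next
    case 2
    note rs = segment_rhombus_closed_segment[OF 2(2), folded 2(1)]
    have "closed_segment p a \<inter> closed_segment p b = {p}" using assms(3) 2 t by blast
    from eventually_rhombi_share_tip[OF this pa 2(2)] eventually_at_right_less[of 0] show ?thesis
    proof eventually_elim
      case (elim e)
      let ?R = "rhombus e p a" and ?S = "rhombus e p b"
      have "a \<in> ?R" using segment_subset_rhombus[OF pa] elim ends_in_segment by blast
      \<comment> \<open>Equal rhombi would both be their intersection \<open>{p}\<close>, which does
        not contain \<open>a\<close>.\<close>
      then have "?R \<noteq> ?S" using elim pa by auto
      moreover have "frontier ?R \<inter> frontier ?S \<subseteq> {p}"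
        using frontier_subset_closed[OF closed_rhombus] elim(1) by blast
      then have "finite (frontier ?R \<inter> frontier ?S) \<and> card (frontier ?R \<inter> frontier ?S) \<le> 2"
        by (auto dest: card_mono[rotated] finite_subset)
      moreover have "t \<inter> s \<noteq> {}" using assms(3) by blast
      ultimately show ?case using elim by (simp add: faithful_pair_def rt rs)
    qed
  qed
qed

lemma eventually_faithful_pair:
  assumes "contact_system S" "s \<in> S" "t \<in> S" "s \<noteq> t"
  shows "\<forall>\<^sub>F e in at_right 0. faithful_pair s t (segment_rhombus e s) (segment_rhombus e t)"
proof (cases "s \<inter> t = {}")
  case True
  obtain a b c d where *: "s = closed_segment a b" "a \<noteq> b" "t = closed_segment c d" "c \<noteq> d"
    using assms unfolding contact_system_def straight_segment_def by metis
  have "\<forall>\<^sub>F e in at_right 0. rhombus e a b \<inter> rhombus e c d = {}"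
    using eventually_rhombi_disjoint True * by blast
  with eventually_at_right_less[of 0] show ?thesis
  proof eventually_elim
    case (elim e)
    have "frontier (rhombus e a b) \<inter> frontier (rhombus e c d) = {}"
      using frontier_subset_closed[OF closed_rhombus] elim by blast
    \<comment> \<open>Disjoint rhombi are distinct because they are nonempty.\<close>
    moreover have "rhombus e a b \<noteq> {}"
      using segment_subset_rhombus[OF *(2), of e] elim by auto
    ultimately show ?case
      using elim True unfolding faithful_pair_def *
      by (auto simp: segment_rhombus_closed_segment *(2,4))
  qed
next
  case False
  then obtain p where "p \<in> s \<inter> t" by blast
  then have p: "s \<inter> t = {p}" using contact_system_Int_unique[OF assms] by blast
  \<comment> \<open>The contact condition does not say whose endpoint \<open>p\<close> is, so
    \<open>eventually_faithful_pair_endpoint\<close> is used in both orders.\<close>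
  have "straight_segment s" "straight_segment t" "segment_endpoint p s \<or> segment_endpoint p t"
    using assms \<open>p \<in> s \<inter> t\<close> by (auto simp: contact_system_def)
  then show ?thesis
    using eventually_faithful_pair_endpoint[of s t p] eventually_faithful_pair_endpoint[of t s p] p
    by (auto simp: faithful_pair_commute[of s t] Int_commute[of t s])
qed

text \<open>The map \<open>f\<close> is itself an isomorphism between the two intersection graphs,
  so composing its inverse with the given isomorphism leads from the image graph to
  \<open>H\<close>.\<close>

lemma digraph_iso_intersection_graph_image:
  assumes inj: "inj_on f S"
    and meet: "\<And>s t. s \<in> S \<Longrightarrow> t \<in> S \<Longrightarrow> s \<noteq> t \<Longrightarrow> f s \<inter> f t \<noteq> {} \<longleftrightarrow> s \<inter> t \<noteq> {}"
    and iso: "digraph_iso (with_proj (intersection_graph S)) H"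
  shows "digraph_iso (with_proj (intersection_graph (f ` S))) H"
proof -
  let ?G = "with_proj (intersection_graph S)" and ?G' = "with_proj (intersection_graph (f ` S))"
  obtain h where h: "pre_digraph.digraph_isomorphism ?G h" "H = app_iso h ?G"
    using iso by (auto simp: digraph_iso_def)
  define g where "g = the_inv_into S f"
  have g: "g (f s) = s" if "s \<in> S" for s
    using that inj by (simp add: g_def the_inv_into_f_f)
  have verts: "verts ?G = g ` verts ?G'"
    by (force simp: intersection_graph_def image_image g)
  have injg: "inj_on g (f ` S)" by (auto simp: inj_on_def g)
  have f_eq: "f s = f t \<longleftrightarrow> s = t" if "s \<in> S" "t \<in> S" for s t
    using inj that by (auto dest: inj_onD)
  have arcs': "arcs ?G' = map_prod f f ` arcs ?G"
  proof (intro equalityI subsetI)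
    fix x assume "x \<in> arcs ?G'"
    then obtain s t where st: "s \<in> S" "t \<in> S" "x = (f s, f t)" "f s \<noteq> f t" "f s \<inter> f t \<noteq> {}"
      by (auto simp: intersection_graph_def)
    then have "(s, t) \<in> arcs ?G" using meet[of s t] by (auto simp: intersection_graph_def)
    with st(3) show "x \<in> map_prod f f ` arcs ?G" by force
  next
    fix x assume "x \<in> map_prod f f ` arcs ?G"
    then obtain s t where st: "s \<in> S" "t \<in> S" "x = (f s, f t)" "s \<noteq> t" "s \<inter> t \<noteq> {}"
      by (auto simp: intersection_graph_def)
    then have "f s \<noteq> f t" "f s \<inter> f t \<noteq> {}" using meet[of s t] f_eq by blast+
    with st show "x \<in> arcs ?G'" by (simp add: intersection_graph_def)
  qed
  have gf: "map_prod g g (map_prod f f x) = x" if "x \<in> arcs ?G" for x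
    using that by (auto simp: intersection_graph_def g)
  have arcs: "arcs ?G = map_prod g g ` arcs ?G'"
    unfolding arcs' by (simp add: image_image gf cong: image_cong)
  \<comment> \<open>The head and tail maps act on arcs of \<open>H\<close>, so they are taken over
    from \<open>h\<close> unchanged.\<close>
  define h' where "h' = \<lparr>iso_verts = iso_verts h \<circ> g, iso_arcs = iso_arcs h \<circ> map_prod g g,
    iso_head = iso_head h, iso_tail = iso_tail h\<rparr>"
  note hD = h(1)[unfolded pre_digraph.digraph_isomorphism_def]
  have "inj_on (map_prod g g) (arcs ?G')"
    unfolding arcs' by (rule inj_on_inverseI[where g = "map_prod f f"], elim imageE) (simp only: gf)
  then have "pre_digraph.digraph_isomorphism ?G' h'"
    unfolding pre_digraph.digraph_isomorphism_def
  proof (intro conjI)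
    show "wf_digraph ?G'" by unfold_locales (auto simp: intersection_graph_def)
    show "inj_on (iso_verts h') (verts ?G')"
      using hD injg verts by (auto simp: h'_def intersection_graph_def intro: comp_inj_on)
    show "inj_on (iso_arcs h') (arcs ?G')" if "inj_on (map_prod g g) (arcs ?G')"
      using hD that arcs by (simp add: h'_def comp_inj_on)
    show "\<forall>a\<in>arcs ?G'. iso_verts h' (tail ?G' a) = iso_tail h' (iso_arcs h' a) \<and>
        iso_verts h' (head ?G' a) = iso_head h' (iso_arcs h' a)"
      using hD unfolding arcs by (auto simp: h'_def)
  qed
  moreover have "H = app_iso h' ?G'"
    unfolding h(2) app_iso_def verts arcs by (simp add: h'_def image_comp)
  ultimately show ?thesis by (auto simp: digraph_iso_def)
qed

theorem theorem4:
  fixes G :: "'v pair_pre_digraph"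
  assumes "contact_segment_graph G"
  shows "pseudo_disk_graph G"
proof -
  obtain S where S: "contact_system S" "digraph_iso (with_proj (intersection_graph S)) (with_proj G)"
    using assms by (auto simp: contact_segment_graph_def)
  have "finite S" using S by (simp add: contact_system_def)
  \<comment> \<open>There are finitely many pairs, so one threshold for \<open>e\<close> serves all
    of them.\<close>
  then have "\<forall>\<^sub>F e in at_right 0. \<forall>s\<in>S. \<forall>t\<in>S. s \<noteq> t \<longrightarrow>
      faithful_pair s t (segment_rhombus e s) (segment_rhombus e t)"
    using eventually_faithful_pair[OF S(1)] by (intro eventually_ball_finite ballI) (auto simp: eventually_conj_iff)
  then have "\<forall>\<^sub>F e in at_right 0. 0 < e \<and> (\<forall>s\<in>S. \<forall>t\<in>S. s \<noteq> t \<longrightarrow>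
      faithful_pair s t (segment_rhombus e s) (segment_rhombus e t))"
    using eventually_at_right_less[of 0] by (simp add: eventually_conj_iff)
  \<comment> \<open>The filter \<open>at_right 0\<close> is nontrivial, so a suitable
    \<open>e\<close> exists.\<close>
  from eventually_happens'[OF trivial_limit_at_right_real this]
  obtain e where "0 < e" and good: "\<And>s t. s \<in> S \<Longrightarrow> t \<in> S \<Longrightarrow> s \<noteq> t \<Longrightarrow>
      faithful_pair s t (segment_rhombus e s) (segment_rhombus e t)"
    by blast
  let ?F = "segment_rhombus e ` S"
  have "pseudo_disk (segment_rhombus e s)" if "s \<in> S" for s
    using that S(1) pseudo_disk_rhombus \<open>0 < e\<close>
    by (auto simp: contact_system_def straight_segment_def segment_rhombus_closed_segment)
  then have "pseudo_disk_system ?F"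
    using \<open>finite S\<close> good by (auto simp: pseudo_disk_system_def faithful_pair_def)
  moreover have "inj_on (segment_rhombus e) S"
    using good by (auto simp: inj_on_def faithful_pair_def)
  then have "digraph_iso (with_proj (intersection_graph ?F)) (with_proj G)"
    using digraph_iso_intersection_graph_image[OF _ _ S(2)] good unfolding faithful_pair_def by blast
  ultimately show ?thesis unfolding pseudo_disk_graph_def by blast
qed

end
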